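(* For every real $m\geq 4$ and every integer $n\geq 3$, let $$A_m=\begin{bmatrix} -m^4 & m^2 & 0 \\ 0 & 0 & m^2 \\ {m^6} & 1 & 0 \end{bmatrix},\qquad A_{m,n}=A_m\oplus(-m^2I_{n-3})\in\mathbb{R}^{n\times n}.$$ Then, for every unitarily invariant norm $\nu$ on $\mathbb{C}^{n\times n}$, $$d_{\mathbb{R},\nu}(A_{m,n})=c_\nu m^2\qquad\text{and}\qquad 0<d_{\mathbb{C},\nu}(A_{m,n})\le c_\nu\left(1+\sqrt{8m^2+9}\right),$$ so that $$\frac{d_{\mathbb{R},\nu}(A_{m,n})}{d_{\mathbb{C},\nu}(A_{m,n})}\ge\frac{m^2}{1+\sqrt{8m^2+9}}\longrightarrow+\infty\quad (m\to+\infty).$$ In particular, for every $m,n$ in the given range, no complex stable matrix nearest to $A_{m,n}$ (in the distance induced by $\nu$) is real.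
   Context: A matrix $X\in\mathbb{C}^{n\times n}$ is called (Hurwitz) stable if all its eigenvalues lie in the closed left half-plane $\{z\in\mathbb{C}:\Re z\le 0\}$ (no condition on defectiveness of eigenvalues on the imaginary axis). Let $\mathcal{E}\subset\mathbb{C}^{n\times n}$ be the set of stable matrices. A norm $\nu$ on $\mathbb{C}^{n\times n}$ is unitarily invariant if $\nu(UXV)=\nu(X)$ for all $X$ and all unitary $U,V$. For such $\nu$ set $c_\nu=\nu(e_1e_1^T)>0$, where $e_1$ is the first standard basis vector. For $A\in\mathbb{R}^{n\times n}$ define $d_{\mathbb{C},\nu}(A)=\min_{X\in\mathcal{E}}\nu(A-X)$ and $d_{\mathbb{R},\nu}(A)=\min_{X\in\mathcal{E}\cap\mathbb{R}^{n\times n}}\nu(A-X)$. A complex stable matrix nearest to $A$ is an $X\in\mathcal{E}$ with $\nu(A-X)=d_{\mathbb{C},\nu}(A)$. $\oplus$ denotes the block diagonal direct sum (for $n=3$, $A_{m,3}=A_m$). *)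

theory Defs
  imports "Jordan_Normal_Form.Schur_Decomposition"
begin

definition real_mats :: "nat \<Rightarrow> complex mat set" where
  "real_mats n = map_mat complex_of_real ` carrier_mat n n"

definition stable_mats :: "nat \<Rightarrow> complex mat set" where
  "stable_mats n = {X \<in> carrier_mat n n. \<forall>z. eigenvalue X z \<longrightarrow> Re z \<le> 0}"

definition unitary_mats :: "nat \<Rightarrow> complex mat set" where
  "unitary_mats n = {U \<in> carrier_mat n n.
     mat_adjoint U * U = 1\<^sub>m n \<and> U * mat_adjoint U = 1\<^sub>m n}"

definition matrix_norm_on :: "nat \<Rightarrow> (complex mat \<Rightarrow> real) \<Rightarrow> bool" where
  \<comment> \<open>a vector space norm on the n by n matrices; submultiplicativity is not required\<close>
  "matrix_norm_on n \<nu> \<longleftrightarrow>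
     (\<forall>X \<in> carrier_mat n n. 0 \<le> \<nu> X) \<and>
     (\<forall>X \<in> carrier_mat n n. \<nu> X = 0 \<longleftrightarrow> X = 0\<^sub>m n n) \<and>
     (\<forall>c. \<forall>X \<in> carrier_mat n n. \<nu> (c \<cdot>\<^sub>m X) = cmod c * \<nu> X) \<and>
     (\<forall>X \<in> carrier_mat n n. \<forall>Y \<in> carrier_mat n n. \<nu> (X + Y) \<le> \<nu> X + \<nu> Y)"

definition unitarily_invariant_norm :: "nat \<Rightarrow> (complex mat \<Rightarrow> real) \<Rightarrow> bool" where
  "unitarily_invariant_norm n \<nu> \<longleftrightarrow> matrix_norm_on n \<nu> \<and>
     (\<forall>X \<in> carrier_mat n n. \<forall>U \<in> unitary_mats n. \<forall>V \<in> unitary_mats n. \<nu> (U * X * V) = \<nu> X)"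

definition norm_const :: "nat \<Rightarrow> (complex mat \<Rightarrow> real) \<Rightarrow> real" where
  \<comment> \<open>the norm of the rank-one matrix formed from the first basis vector (index 0) and its transpose\<close>
  "norm_const n \<nu> = \<nu> (mat_of_cols n [unit_vec n 0] * mat_of_rows n [unit_vec n 0])"

text \<open>The two distances are minima in the source. They are defined here as infima, so a claim that
  needs the minimum to exist has to state that it is attained.\<close>

definition dist_complex :: "nat \<Rightarrow> (complex mat \<Rightarrow> real) \<Rightarrow> real mat \<Rightarrow> real" where
  "dist_complex n \<nu> A = (INF X \<in> stable_mats n. \<nu> (map_mat complex_of_real A - X))"

definition dist_real :: "nat \<Rightarrow> (complex mat \<Rightarrow> real) \<Rightarrow> real mat \<Rightarrow> real" where
  "dist_real n \<nu> A = (INF X \<in> stable_mats n \<inter> real_mats n. \<nu> (map_mat complex_of_real A - X))"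

definition nearest_complex_stable ::
  "nat \<Rightarrow> (complex mat \<Rightarrow> real) \<Rightarrow> real mat \<Rightarrow> complex mat \<Rightarrow> bool" where
  "nearest_complex_stable n \<nu> A X \<longleftrightarrow>
     X \<in> stable_mats n \<and> \<nu> (map_mat complex_of_real A - X) = dist_complex n \<nu> A"

definition nearest_real_stable ::
  "nat \<Rightarrow> (complex mat \<Rightarrow> real) \<Rightarrow> real mat \<Rightarrow> complex mat \<Rightarrow> bool" where
  "nearest_real_stable n \<nu> A X \<longleftrightarrow>
     X \<in> stable_mats n \<inter> real_mats n \<and> \<nu> (map_mat complex_of_real A - X) = dist_real n \<nu> A"

definition A3 :: "real \<Rightarrow> real mat" where
  "A3 m = mat_of_rows_list 3
     [[- (m ^ 4), m ^ 2, 0],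
      [0,         0,     m ^ 2],
      [m ^ 6,     1,     0]]"

definition A_mat :: "real \<Rightarrow> nat \<Rightarrow> real mat" where
  "A_mat m n = diag_block_mat [A3 m, - (m ^ 2) \<cdot>\<^sub>m 1\<^sub>m (n - 3)]"

end

theory Submission
  imports Defs
begin

text \<open>
  For real perturbations, \<open>det (-(A - t E))\<close> is negative at
  \<open>t = 0\<close> and nonnegative at \<open>t = 1\<close> if \<open>A - E\<close> is stable, so the segment meets a
  singular matrix: \<open>A v = t E v\<close> with \<open>v \<noteq> 0\<close>. As the
  columns of \<open>A\<close> are pairwise orthogonal, its smallest singular value is exactly \<open>m\<^sup>2\<close>,
  and every unitarily invariant norm is at least \<open>c\<^sub>\<nu>\<close> times the spectral norm.
  A complex perturbation of rank two instead moves the large positive eigenvalue (about \<open>m\<^sup>3\<close>)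
  together with the one near \<open>-m\<^sup>3\<close> to a double eigenvalue \<open>i m\<^sup>3\<close>, at cost of order \<open>m\<close> only.
\<close>

section \<open>Vectors as functions on indices below \<open>n\<close>, rank-one matrices,
  Householder reflections\<close>

definition l2 :: "nat \<Rightarrow> (nat \<Rightarrow> complex) \<Rightarrow> real" where
  "l2 n x = sqrt (\<Sum>i<n. (cmod (x i))\<^sup>2)"

definition outer :: "nat \<Rightarrow> (nat \<Rightarrow> complex) \<Rightarrow> (nat \<Rightarrow> complex) \<Rightarrow> complex mat" where
  "outer n x y = mat n n (\<lambda>(i, j). x i * cnj (y j))"

text \<open>The Householder reflection along \<open>w\<close>. If \<open>w\<close> vanishes on the
  indices below \<open>n\<close>, division by zero yields 0 and the matrix is the identity, so no
  hypothesis on \<open>w\<close> is carried along.\<close>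

definition refl_mat :: "nat \<Rightarrow> (nat \<Rightarrow> complex) \<Rightarrow> complex mat" where
  "refl_mat n w = mat n n (\<lambda>(i, j). of_bool (i = j) - 2 / of_real ((l2 n w)\<^sup>2) * (w i * cnj (w j)))"

definition app :: "nat \<Rightarrow> complex mat \<Rightarrow> (nat \<Rightarrow> complex) \<Rightarrow> nat \<Rightarrow> complex" where
  "app n E x i = (\<Sum>j<n. E $$ (i, j) * x j)"

lemma l2_nonneg [simp]: "0 \<le> l2 n x"
  by (simp add: l2_def sum_nonneg)

lemma l2_sq: "(l2 n x)\<^sup>2 = (\<Sum>i<n. (cmod (x i))\<^sup>2)"
  by (simp add: l2_def sum_nonneg)

lemma of_real_l2_sq: "complex_of_real ((l2 n x)\<^sup>2) = (\<Sum>i<n. cnj (x i) * x i)"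
  unfolding l2_sq of_real_sum by (rule sum.cong) (simp_all add: complex_norm_square mult.commute flip: of_real_power)

lemma l2_eq_0_iff: "l2 n x = 0 \<longleftrightarrow> (\<forall>i<n. x i = 0)"
  by (auto simp: l2_def sum_nonneg_eq_0_iff)

lemma cmod_le_l2: "i < n \<Longrightarrow> cmod (x i) \<le> l2 n x"
  unfolding l2_def by (rule real_le_rsqrt) (rule member_le_sum, auto)

lemma l2_of_bool: "j < n \<Longrightarrow> l2 n (\<lambda>i. of_bool (i = j)) = 1"
  by (simp add: l2_def of_bool_def if_distrib if_distribR sum.delta cong: if_cong)

lemma outer_carrier [simp]: "outer n x y \<in> carrier_mat n n"
  by (simp add: outer_def)

lemma refl_mat_carrier [simp]: "refl_mat n w \<in> carrier_mat n n"
  by (simp add: refl_mat_def)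

lemma mult_index:
  "A \<in> carrier_mat n n \<Longrightarrow> B \<in> carrier_mat n n \<Longrightarrow> i < n \<Longrightarrow> j < n \<Longrightarrow>
    (A * B) $$ (i, j) = (\<Sum>k<n. A $$ (i, k) * B $$ (k, j))"
  by (auto simp: scalar_prod_def atLeast0LessThan)

lemma app_refl_mat:
  assumes "i < n"
  shows "app n (refl_mat n w) x i = x i - 2 / of_real ((l2 n w)\<^sup>2) * w i * (\<Sum>j<n. cnj (w j) * x j)"
proof -
  have "app n (refl_mat n w) x i
      = (\<Sum>j<n. of_bool (i = j) * x j - 2 / of_real ((l2 n w)\<^sup>2) * w i * (cnj (w j) * x j))"
    unfolding app_def refl_mat_def using assms by (intro sum.cong) (auto simp: algebra_simps)
  also have "\<dots> = (\<Sum>j<n. of_bool (i = j) * x j) - 2 / of_real ((l2 n w)\<^sup>2) * w i * (\<Sum>j<n. cnj (w j) * x j)"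
    by (simp only: sum_subtractf sum_distrib_left)
  also have "(\<Sum>j<n. of_bool (i = j) * x j) = x i"
    using assms by (simp add: of_bool_def if_distribR if_distrib cong: if_cong)
  finally show ?thesis .
qed

lemma refl_mat_index:
  "i < n \<Longrightarrow> j < n \<Longrightarrow> refl_mat n w $$ (i, j) = of_bool (i = j) - 2 / of_real ((l2 n w)\<^sup>2) * (w i * cnj (w j))"
  by (simp add: refl_mat_def)

lemma cnj_refl_mat: "i < n \<Longrightarrow> j < n \<Longrightarrow> cnj (refl_mat n w $$ (i, j)) = refl_mat n w $$ (j, i)"
  by (auto simp: refl_mat_index)

lemma refl_mat_involution: "refl_mat n w * refl_mat n w = 1\<^sub>m n"
proof (rule eq_matI)
  fix i j assume "i < dim_row (1\<^sub>m n :: complex mat)" "j < dim_col (1\<^sub>m n :: complex mat)"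
  then have ij: "i < n" "j < n" by auto
  define s where "s = complex_of_real ((l2 n w)\<^sup>2)"
  have "(refl_mat n w * refl_mat n w) $$ (i, j) = app n (refl_mat n w) (\<lambda>k. refl_mat n w $$ (k, j)) i"
    using ij by (simp add: mult_index app_def)
  also have "\<dots> = refl_mat n w $$ (i, j) - 2 / s * w i * (\<Sum>k<n. cnj (w k) * refl_mat n w $$ (k, j))"
    unfolding s_def by (rule app_refl_mat[OF ij(1)])
  \<comment> \<open>Hermitian symmetry turns the pairing of \<open>w\<close> with column
    \<open>j\<close> into the conjugate of the reflected \<open>w\<close>.\<close>
  also have "(\<Sum>k<n. cnj (w k) * refl_mat n w $$ (k, j)) = cnj (app n (refl_mat n w) w j)"
    unfolding app_def cnj_sum using ij
    by (intro sum.cong) (simp_all add: cnj_refl_mat mult.commute)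
  also have "app n (refl_mat n w) w j = w j - 2 / s * w j * s"
    unfolding app_refl_mat[OF ij(2)] of_real_l2_sq s_def by simp
  also have "cnj \<dots> = cnj (w j) - 2 / s * cnj (w j) * s"
    by (simp add: s_def)
  finally have "(refl_mat n w * refl_mat n w) $$ (i, j)
      = of_bool (i = j) - 2 / s * (w i * cnj (w j)) - 2 / s * w i * (cnj (w j) - 2 / s * cnj (w j) * s)"
    by (simp add: refl_mat_index ij s_def)
  \<comment> \<open>For \<open>s = 0\<close> all correction terms vanish because
    \<open>2 / s\<close> is 0; otherwise \<open>s\<close> cancels.\<close>
  also have "\<dots> = of_bool (i = j)" by (cases "s = 0") (simp_all add: field_simps)
  finally show "(refl_mat n w * refl_mat n w) $$ (i, j) = 1\<^sub>m n $$ (i, j)" using ij by simp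
qed (simp_all add: refl_mat_def)

lemma mat_adjoint_refl_mat: "mat_adjoint (refl_mat n w) = refl_mat n w"
proof (rule eq_matI)
  fix i j assume "i < dim_row (refl_mat n w)" "j < dim_col (refl_mat n w)"
  then have ij: "i < n" "j < n" by (simp_all add: refl_mat_def)
  have d: "dim_row (refl_mat n w) = n" "dim_col (refl_mat n w) = n" by (simp_all add: refl_mat_def)
  have "mat_adjoint (refl_mat n w) $$ (i, j) = cnj (refl_mat n w $$ (j, i))"
    unfolding mat_adjoint_def using ij d by (simp add: mat_of_rows_index)
  then show "mat_adjoint (refl_mat n w) $$ (i, j) = refl_mat n w $$ (i, j)"
    by (simp add: cnj_refl_mat ij)
qed (simp_all add: refl_mat_def mat_adjoint_def)

lemma refl_mat_unitary: "refl_mat n w \<in> unitary_mats n"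
  by (simp add: unitary_mats_def mat_adjoint_refl_mat refl_mat_involution)

lemma one_unitary: "1\<^sub>m n \<in> unitary_mats n"
proof -
  have "refl_mat n (\<lambda>_. 0) = 1\<^sub>m n" by (rule eq_matI) (auto simp: refl_mat_def)
  then show ?thesis using refl_mat_unitary[of n "\<lambda>_. 0"] by simp
qed

lemma mult_outer:
  assumes "A \<in> carrier_mat n n"
  shows "A * outer n x y = outer n (app n A x) y"
proof (rule eq_matI)
  fix i j assume "i < dim_row (outer n (app n A x) y)" "j < dim_col (outer n (app n A x) y)"
  then have ij: "i < n" "j < n" by (simp_all add: outer_def)
  then show "(A * outer n x y) $$ (i, j) = outer n (app n A x) y $$ (i, j)"
    unfolding mult_index[OF assms outer_carrier ij]
    by (simp add: outer_def app_def sum_distrib_right mult.assoc)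
qed (use assms in \<open>auto simp: outer_def\<close>)

text \<open>Multiplication on the right acts on \<open>y\<close> through the adjoint, and a
  reflection is its own adjoint.\<close>

lemma outer_mult_refl_mat: "outer n x y * refl_mat n w = outer n x (app n (refl_mat n w) y)"
proof (rule eq_matI)
  fix i j assume "i < dim_row (outer n x (app n (refl_mat n w) y))" "j < dim_col (outer n x (app n (refl_mat n w) y))"
  then have ij: "i < n" "j < n" by (simp_all add: outer_def)
  have "(outer n x y * refl_mat n w) $$ (i, j) = (\<Sum>k<n. outer n x y $$ (i, k) * refl_mat n w $$ (k, j))"
    by (rule mult_index) (use ij in auto)
  also have "\<dots> = x i * cnj (app n (refl_mat n w) y j)"
    unfolding app_def cnj_sum sum_distrib_left
    by (rule sum.cong) (use ij in \<open>auto simp: outer_def cnj_refl_mat\<close>)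
  finally show "(outer n x y * refl_mat n w) $$ (i, j) = outer n x (app n (refl_mat n w) y) $$ (i, j)"
    using ij by (simp add: outer_def)
qed (auto simp: outer_def refl_mat_def)

text \<open>The phase \<open>\<alpha>\<close> is chosen to make the inner product of \<open>x\<close> with \<open>\<alpha> e\<^sub>0\<close> real, which is what the
  complex Householder reflection swapping the two vectors requires.\<close>

lemma reflect_to_axis:
  assumes "0 < n"
  obtains w \<alpha> where "cmod \<alpha> = 1"
    "\<And>i. i < n \<Longrightarrow> app n (refl_mat n w) x i = of_real (l2 n x) * \<alpha> * of_bool (i = 0)"
proof -
  define \<alpha> where "\<alpha> = (if x 0 = 0 then 1 else sgn (x 0))"
  define r where "r = l2 n x"
  define w where "w i = x i - of_real r * \<alpha> * of_bool (i = 0)" for i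
  have \<alpha>: "cmod \<alpha> = 1" by (simp add: \<alpha>_def norm_sgn)
  have \<alpha>2: "cnj \<alpha> * \<alpha> = 1" using complex_norm_square[of \<alpha>] \<alpha> by (simp add: mult.commute)
  have \<alpha>x: "cnj \<alpha> * x 0 = of_real (cmod (x 0))"
  proof (cases "x 0 = 0")
    case False
    then have "x 0 = of_real (cmod (x 0)) * \<alpha>" by (simp add: \<alpha>_def sgn_div_norm scaleR_conv_of_real)
    then have "cnj \<alpha> * x 0 = of_real (cmod (x 0)) * (cnj \<alpha> * \<alpha>)" by (metis mult.left_commute)
    then show ?thesis using \<alpha>2 by simp
  qed simp
  have xw: "(\<Sum>j<n. cnj (w j) * x j) = of_real (r\<^sup>2) - of_real r * of_real (cmod (x 0))"
  proof -
    have "(\<Sum>j<n. cnj (w j) * x j) = (\<Sum>j<n. cnj (x j) * x j - (of_real r * (cnj \<alpha> * x 0)) * of_bool (j = 0))"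
      by (rule sum.cong) (auto simp: w_def algebra_simps)
    also have "\<dots> = (\<Sum>j<n. cnj (x j) * x j) - of_real r * (cnj \<alpha> * x 0)"
      unfolding sum_subtractf using assms by (simp add: of_bool_def if_distrib cong: if_cong)
    finally show ?thesis by (simp add: \<alpha>x r_def flip: of_real_l2_sq)
  qed
  \<comment> \<open>Twice the pairing of \<open>w\<close> with \<open>x\<close> equals the squared
    length of \<open>w\<close>; this is exactly the condition under which the reflection sends
    \<open>x\<close> to \<open>x - w\<close>.\<close>
  have ww: "of_real ((l2 n w)\<^sup>2) = 2 * (\<Sum>j<n. cnj (w j) * x j)"
  proof -
    have "of_real ((l2 n w)\<^sup>2) = (\<Sum>j<n. cnj (w j) * x j - (of_real r * \<alpha> * cnj (w 0)) * of_bool (j = 0))"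
      unfolding of_real_l2_sq by (rule sum.cong) (auto simp: w_def algebra_simps)
    also have "\<dots> = (\<Sum>j<n. cnj (w j) * x j) - of_real r * \<alpha> * cnj (w 0)"
      unfolding sum_subtractf using assms by (simp add: of_bool_def if_distrib cong: if_cong)
    also have "of_real r * \<alpha> * cnj (w 0) = of_real r * (cnj (cnj \<alpha> * x 0) - of_real r * (cnj \<alpha> * \<alpha>))"
      by (simp add: w_def algebra_simps)
    also have "\<dots> = of_real r * (of_real (cmod (x 0)) - of_real r)"
      unfolding \<alpha>x \<alpha>2 by simp
    finally show ?thesis unfolding xw by (simp add: algebra_simps power2_eq_square)
  qed
  have "app n (refl_mat n w) x i = of_real r * \<alpha> * of_bool (i = 0)" if "i < n" for i
  \<comment> \<open>If \<open>w\<close> vanishes, \<open>x\<close> already lies on the axis and the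
    reflection is the identity.\<close>
  proof (cases "l2 n w = 0")
    case True
    then show ?thesis using that by (auto simp: app_refl_mat l2_eq_0_iff w_def)
  next
    case False
    then have "of_real ((l2 n w)\<^sup>2) \<noteq> (0::complex)" by simp
    then have "app n (refl_mat n w) x i = x i - w i"
      unfolding app_refl_mat[OF that] ww by (simp add: field_simps)
    then show ?thesis by (simp add: w_def)
  qed
  with \<alpha> show thesis using that unfolding r_def by blast
qed

section \<open>Unitarily invariant norms: rank-one matrices and the bound by the spectral
  norm\<close>

locale unitarily_invariant =
  fixes n :: nat and \<nu> :: "complex mat \<Rightarrow> real"
  assumes pos: "0 < n" and inv: "unitarily_invariant_norm n \<nu>"
begin

lemma norm_nonneg: "X \<in> carrier_mat n n \<Longrightarrow> 0 \<le> \<nu> X"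
  and norm_0_iff: "X \<in> carrier_mat n n \<Longrightarrow> \<nu> X = 0 \<longleftrightarrow> X = 0\<^sub>m n n"
  and norm_smult: "X \<in> carrier_mat n n \<Longrightarrow> \<nu> (c \<cdot>\<^sub>m X) = cmod c * \<nu> X"
  and norm_triangle: "X \<in> carrier_mat n n \<Longrightarrow> Y \<in> carrier_mat n n \<Longrightarrow> \<nu> (X + Y) \<le> \<nu> X + \<nu> Y"
  and norm_invariant: "X \<in> carrier_mat n n \<Longrightarrow> U \<in> unitary_mats n \<Longrightarrow> V \<in> unitary_mats n \<Longrightarrow>
    \<nu> (U * X * V) = \<nu> X"
  using inv unfolding unitarily_invariant_norm_def matrix_norm_on_def by blast+

abbreviation "c\<^sub>\<nu> \<equiv> norm_const n \<nu>"

lemma norm_const_outer: "c\<^sub>\<nu> = \<nu> (outer n (\<lambda>i. of_bool (i = 0)) (\<lambda>i. of_bool (i = 0)))"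
proof -
  have "mat_of_cols n [unit_vec n 0] * mat_of_rows n [unit_vec n 0]
      = outer n (\<lambda>i. of_bool (i = 0)) (\<lambda>i. of_bool (i = 0))"
    by (rule eq_matI)
      (auto simp: outer_def scalar_prod_def mat_of_cols_def mat_of_rows_def unit_vec_def)
  then show ?thesis by (simp add: norm_const_def)
qed

lemma norm_const_pos: "0 < c\<^sub>\<nu>"
proof -
  let ?e = "\<lambda>i. of_bool (i = (0::nat)) :: complex"
  have "outer n ?e ?e $$ (0, 0) \<noteq> 0\<^sub>m n n $$ (0, 0)" using pos by (simp add: outer_def)
  then have "outer n ?e ?e \<noteq> 0\<^sub>m n n" by metis
  then show ?thesis
    using norm_0_iff[of "outer n ?e ?e"] norm_nonneg[of "outer n ?e ?e"]
    by (simp add: norm_const_outer)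
qed

text \<open>Reflections on the left and on the right carry \<open>x\<close> and \<open>y\<close> to
  multiples of the first basis vector; the phases have modulus 1 and drop out of the norm.\<close>

lemma norm_outer: "\<nu> (outer n x y) = c\<^sub>\<nu> * l2 n x * l2 n y"
proof -
  let ?e = "\<lambda>i. of_bool (i = (0::nat)) :: complex"
  obtain u \<alpha> where u: "cmod \<alpha> = 1"
    "\<And>i. i < n \<Longrightarrow> app n (refl_mat n u) x i = of_real (l2 n x) * \<alpha> * of_bool (i = 0)"
    using reflect_to_axis[OF pos] by blast
  obtain v \<beta> where v: "cmod \<beta> = 1"
    "\<And>i. i < n \<Longrightarrow> app n (refl_mat n v) y i = of_real (l2 n y) * \<beta> * of_bool (i = 0)"
    using reflect_to_axis[OF pos] by blast
  have "\<nu> (outer n x y) = \<nu> (refl_mat n u * outer n x y * refl_mat n v)"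
    by (simp add: norm_invariant refl_mat_unitary)
  also have "refl_mat n u * outer n x y * refl_mat n v
      = outer n (app n (refl_mat n u) x) (app n (refl_mat n v) y)"
    by (simp add: mult_outer outer_mult_refl_mat)
  also have "\<dots> = (of_real (l2 n x) * \<alpha> * (of_real (l2 n y) * cnj \<beta>)) \<cdot>\<^sub>m outer n ?e ?e"
    by (rule eq_matI) (auto simp: outer_def u v)
  finally show ?thesis
    by (simp add: norm_smult norm_mult u(1) v(1) flip: norm_const_outer)
qed

text \<open>With \<open>R\<close> the reflection along \<open>x\<close>, the difference
  \<open>E - E * R\<close> is the rank-one matrix \<open>outer n (app n E x) x\<close> times
  \<open>2 / (l2 n x)^2\<close>. Its norm is known exactly, and by the triangle inequality and
  invariance it is at most twice that of \<open>E\<close>. This gives the comparison with the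
  spectral norm without a singular value decomposition.\<close>

lemma norm_ge_app:
  assumes E: "E \<in> carrier_mat n n"
  shows "c\<^sub>\<nu> * l2 n (app n E x) \<le> \<nu> E * l2 n x"
proof (cases "l2 n x = 0")
  case True
  then have "app n E x = (\<lambda>_. 0)" by (auto simp: l2_eq_0_iff app_def)
  then have "l2 n (app n E x) = 0" by (simp add: l2_eq_0_iff)
  with True show ?thesis by simp
next
  case False
  define s where "s = (l2 n x)\<^sup>2"
  have s: "s > 0" using False by (simp add: s_def)
  let ?R = "E * refl_mat n x"
  have R: "?R \<in> carrier_mat n n" using E by simp
  have "outer n (app n E x) x = of_real (s / 2) \<cdot>\<^sub>m (E + (-1) \<cdot>\<^sub>m ?R)"
  proof (rule eq_matI)
    fix i j assume "i < dim_row (of_real (s / 2) \<cdot>\<^sub>m (E + (-1) \<cdot>\<^sub>m ?R))" "j < dim_col (of_real (s / 2) \<cdot>\<^sub>m (E + (-1) \<cdot>\<^sub>m ?R))"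
    then have ij: "i < n" "j < n" using E by (auto simp: refl_mat_def)
    have "?R $$ (i, j) = (\<Sum>k<n. E $$ (i, k) * of_bool (k = j) - E $$ (i, k) * x k * (2 / of_real s * cnj (x j)))"
      using ij E unfolding mult_index[OF E refl_mat_carrier ij]
      by (intro sum.cong) (auto simp: refl_mat_index s_def algebra_simps)
    also have "\<dots> = E $$ (i, j) - app n E x i * (2 / of_real s * cnj (x j))"
      unfolding sum_subtractf app_def sum_distrib_right using ij
      by (simp add: of_bool_def if_distrib cong: if_cong)
    finally have "outer n (app n E x) x $$ (i, j) = of_real (s / 2) * (E $$ (i, j) - ?R $$ (i, j))"
      using ij s by (simp add: outer_def field_simps)
    also have "\<dots> = (of_real (s / 2) \<cdot>\<^sub>m (E + (-1) \<cdot>\<^sub>m ?R)) $$ (i, j)"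
      using ij carrier_matD[OF E] carrier_matD[OF R] by (simp del: index_mult_mat(1))
    finally show "outer n (app n E x) x $$ (i, j) = (of_real (s / 2) \<cdot>\<^sub>m (E + (-1) \<cdot>\<^sub>m ?R)) $$ (i, j)" .
  qed (use E in \<open>auto simp: outer_def refl_mat_def\<close>)
  then have "\<nu> (outer n (app n E x) x) = s / 2 * \<nu> (E + (-1) \<cdot>\<^sub>m ?R)"
    using E R s by (simp add: norm_smult)
  also have "\<dots> \<le> s / 2 * (\<nu> E + \<nu> ((-1) \<cdot>\<^sub>m ?R))"
    using s norm_triangle[of E "(-1) \<cdot>\<^sub>m ?R"] E R by (intro mult_left_mono) auto
  also have "\<nu> ((-1) \<cdot>\<^sub>m ?R) = \<nu> E"
    using norm_smult[OF R, of "-1"] norm_invariant[OF E one_unitary refl_mat_unitary, of x] E by simp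
  finally have "c\<^sub>\<nu> * l2 n (app n E x) * l2 n x \<le> \<nu> E * l2 n x * l2 n x"
    unfolding norm_outer by (simp add: s_def power2_eq_square algebra_simps)
  then show ?thesis using False l2_nonneg[of n x] by (simp add: mult_le_cancel_right)
qed

text \<open>The previous bound at a basis vector; it makes the entries of a minimizing sequence
  bounded.\<close>

lemma norm_ge_entry:
  assumes E: "E \<in> carrier_mat n n" and ij: "i < n" "j < n"
  shows "c\<^sub>\<nu> * cmod (E $$ (i, j)) \<le> \<nu> E"
proof -
  let ?e = "\<lambda>k. of_bool (k = j) :: complex"
  have "app n E ?e i = E $$ (i, j)"
    using ij by (simp add: app_def of_bool_def if_distrib cong: if_cong)
  then have "cmod (E $$ (i, j)) \<le> l2 n (app n E ?e)"
    using cmod_le_l2[OF ij(1), of "app n E ?e"] by simp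
  then have "c\<^sub>\<nu> * cmod (E $$ (i, j)) \<le> c\<^sub>\<nu> * l2 n (app n E ?e)"
    using norm_const_pos by simp
  also have "\<dots> \<le> \<nu> E" using norm_ge_app[OF E, of ?e] ij by (simp add: l2_of_bool)
  finally show ?thesis .
qed

end

section \<open>Closedness of the set of stable matrices\<close>

text \<open>The determinant is a polynomial in the entries. The filter is arbitrary because the
  lemma serves both sequences of matrices and continuity along a real segment.\<close>

lemma tendsto_det:
  fixes X :: "'b \<Rightarrow> 'a :: real_normed_field mat"
  assumes X: "\<And>k. X k \<in> carrier_mat n n" and L: "L \<in> carrier_mat n n"
    and lim: "\<And>i j. i < n \<Longrightarrow> j < n \<Longrightarrow> ((\<lambda>k. X k $$ (i, j)) \<longlongrightarrow> L $$ (i, j)) F"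
  shows "((\<lambda>k. det (X k)) \<longlongrightarrow> det L) F"
  unfolding det_def'[OF X] det_def'[OF L]
proof (intro tendsto_sum tendsto_mult tendsto_const tendsto_prod lim)
  fix p i assume "p \<in> {p. p permutes {0..<n}}" "i \<in> {0..<n}"
  then show "i < n" "p i < n" using permutes_in_image[of p "{0..<n}" i] by auto
qed

lemma poly_char_poly:
  fixes X :: "'a :: field mat"
  assumes "X \<in> carrier_mat n n"
  shows "poly (char_poly X) z = det (z \<cdot>\<^sub>m 1\<^sub>m n - X)"
proof -
  have "- char_matrix X z = z \<cdot>\<^sub>m 1\<^sub>m n - X"
    using assms by (intro eq_matI) (auto simp: char_matrix_def)
  then show ?thesis by (simp add: char_poly_matrix[OF assms])
qed

text \<open>Over the complex numbers the characteristic polynomial is a product of \<open>n\<close>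
  factors \<open>z - a\<close> with \<open>Re a \<le> 0\<close>, and each has modulus at least
  \<open>Re (z - a) \<ge> Re z\<close>.\<close>

lemma stable_char_poly_bound:
  assumes X: "X \<in> stable_mats n" and z: "0 < Re z"
  shows "Re z ^ n \<le> cmod (poly (char_poly X) z)"
proof -
  have Xc: "X \<in> carrier_mat n n" using X by (simp add: stable_mats_def)
  obtain as where as: "char_poly X = (\<Prod>a\<leftarrow>as. [:- a, 1:])" "length as = n"
    using char_poly_factorized[OF Xc] by blast
  have "Re a \<le> 0" if "a \<in> set as" for a
  proof -
    have "poly (char_poly X) a = 0"
      using that by (force simp: as(1) poly_prod_list prod_list_zero_iff o_def)
    then show ?thesis using X eigenvalue_root_char_poly[OF Xc] by (auto simp: stable_mats_def)
  qed
  then have "Re z ^ length as \<le> cmod (poly (\<Prod>a\<leftarrow>as. [:- a, 1:]) z)"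
  proof (induction as)
    case (Cons a as)
    have "Re z \<le> cmod (z - a)"
      using Cons.prems[of a] complex_Re_le_cmod[of "z - a"] by simp
    moreover have "Re z ^ length as \<le> cmod (poly (\<Prod>a\<leftarrow>as. [:- a, 1:]) z)"
      using Cons by simp
    ultimately have "Re z * Re z ^ length as \<le> cmod (z - a) * cmod (poly (\<Prod>a\<leftarrow>as. [:- a, 1:]) z)"
      using z by (intro mult_mono) auto
    also have "\<dots> = cmod (poly (\<Prod>a\<leftarrow>a # as. [:- a, 1:]) z)"
      by (simp add: norm_mult[symmetric] algebra_simps)
    finally show ?case by simp
  qed simp
  then show ?thesis by (simp add: as)
qed

text \<open>The lower bound on the characteristic polynomial survives in the limit, which replaces
  continuity of the eigenvalues.\<close>

lemma stable_mats_limit: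
  assumes X: "\<And>k. X k \<in> stable_mats n" and L: "L \<in> carrier_mat n n"
    and lim: "\<And>i j. i < n \<Longrightarrow> j < n \<Longrightarrow> (\<lambda>k. X k $$ (i, j)) \<longlonglongrightarrow> L $$ (i, j)"
  shows "L \<in> stable_mats n"
proof -
  have Xc: "X k \<in> carrier_mat n n" for k using X[of k] by (simp add: stable_mats_def)
  have "\<not> 0 < Re z" if "eigenvalue L z" for z
  proof
    assume z: "0 < Re z"
    have "(\<lambda>k. det (z \<cdot>\<^sub>m 1\<^sub>m n - X k)) \<longlonglongrightarrow> det (z \<cdot>\<^sub>m 1\<^sub>m n - L)"
    proof (rule tendsto_det)
      fix i j assume ij: "i < n" "j < n"
      have "(\<lambda>k. (z \<cdot>\<^sub>m 1\<^sub>m n) $$ (i, j) - X k $$ (i, j)) \<longlonglongrightarrow> (z \<cdot>\<^sub>m 1\<^sub>m n) $$ (i, j) - L $$ (i, j)"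
        by (intro tendsto_intros lim ij)
      then show "(\<lambda>k. (z \<cdot>\<^sub>m 1\<^sub>m n - X k) $$ (i, j)) \<longlonglongrightarrow> (z \<cdot>\<^sub>m 1\<^sub>m n - L) $$ (i, j)"
        using ij carrier_matD[OF L] carrier_matD[OF Xc] by simp
    qed (simp_all add: minus_carrier_mat Xc L)
    then have "(\<lambda>k. cmod (poly (char_poly (X k)) z)) \<longlonglongrightarrow> cmod (poly (char_poly L) z)"
      unfolding poly_char_poly[OF Xc] poly_char_poly[OF L] by (rule tendsto_norm)
    then have "Re z ^ n \<le> cmod (poly (char_poly L) z)"
      using stable_char_poly_bound[OF X z] by (intro LIMSEQ_le_const) auto
    moreover have "poly (char_poly L) z = 0" using that eigenvalue_root_char_poly[OF L] by simp
    ultimately show False using zero_less_power[OF z, of n] by simp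
  qed
  then show ?thesis using L by (auto simp: stable_mats_def not_less)
qed

section \<open>Compactness and existence of a nearest complex stable matrix\<close>

text \<open>Bounded monotone real sequences converge, and every real sequence has a monotone
  subsequence; apply this to the real parts, then to the imaginary parts along the subsequence
  found.\<close>

lemma Bseq_convergent_subseq_complex:
  fixes f :: "nat \<Rightarrow> complex"
  assumes "Bseq f"
  obtains r where "strict_mono r" "convergent (f \<circ> r)"
proof -
  obtain B where B: "cmod (f k) \<le> B" for k using assms by (auto simp: Bseq_def)
  have real: "\<exists>s. strict_mono s \<and> convergent (g \<circ> s)" if "\<And>k. \<bar>g k\<bar> \<le> B" for g :: "nat \<Rightarrow> real"
  proof -
    obtain s where s: "strict_mono s" "monoseq (\<lambda>k. g (s k))" using seq_monosub[of g] by blast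
    have "Bseq (\<lambda>k. g (s k))" using that by (intro BseqI'[of _ B]) simp
    then show ?thesis using Bseq_monoseq_convergent[OF _ s(2)] s(1) by (auto simp: o_def)
  qed
  obtain s where s: "strict_mono s" "convergent ((\<lambda>k. Re (f k)) \<circ> s)"
    using real[of "\<lambda>k. Re (f k)"] abs_Re_le_cmod B order_trans by meson
  obtain t where t: "strict_mono t" "convergent ((\<lambda>k. Im (f (s k))) \<circ> t)"
    using real[of "\<lambda>k. Im (f (s k))"] abs_Im_le_cmod B order_trans by meson
  obtain a b where "(\<lambda>k. Re (f (s k))) \<longlonglongrightarrow> a" "(\<lambda>k. Im (f (s (t k)))) \<longlonglongrightarrow> b"
    using s(2) t(2) by (auto simp: convergent_def o_def)
  moreover from this(1) have "(\<lambda>k. Re (f (s (t k)))) \<longlonglongrightarrow> a"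
    using LIMSEQ_subseq_LIMSEQ[OF _ t(1)] by (force simp: o_def)
  ultimately have "(\<lambda>k. f (s (t k))) \<longlonglongrightarrow> Complex a b"
    by (simp add: tendsto_complex_iff)
  then have "convergent (f \<circ> (s \<circ> t))" by (auto simp: convergent_def o_def)
  then show thesis using that strict_mono_o[OF s(1) t(1)] by blast
qed

text \<open>Thin out for one member of the family at a time; convergence already obtained survives
  further thinning. The index set will be the positions of a matrix.\<close>

lemma finite_family_convergent_subseq:
  fixes f :: "'i \<Rightarrow> nat \<Rightarrow> complex"
  assumes "finite S" and "\<And>i. i \<in> S \<Longrightarrow> Bseq (f i)"
  shows "\<exists>r. strict_mono r \<and> (\<forall>i\<in>S. convergent (f i \<circ> r))"
  using assms
proof (induction S)
  case empty
  show ?case by (rule exI[of _ id]) (simp add: strict_mono_def)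
next
  case (insert i S)
  then obtain r where r: "strict_mono r" "\<forall>j\<in>S. convergent (f j \<circ> r)" by blast
  have "Bseq (f i \<circ> r)" using insert.prems[of i] by (auto simp: Bseq_def)
  then obtain s where s: "strict_mono s" "convergent (f i \<circ> r \<circ> s)"
    by (rule Bseq_convergent_subseq_complex)
  have "convergent (f j \<circ> r \<circ> s)" if "j \<in> S" for j
    using r(2) that convergent_subseq_convergent[OF _ s(1)] by blast
  then have "\<forall>j\<in>insert i S. convergent (f j \<circ> (r \<circ> s))" using s(2) by (auto simp only: o_assoc)
  then show ?case using strict_mono_o[OF r(1) s(1)] by blast
qed

context unitarily_invariant
begin

lemma norm_triangle_minus:
  assumes "X \<in> carrier_mat n n" "Y \<in> carrier_mat n n" "Z \<in> carrier_mat n n"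
  shows "\<nu> (X - Z) \<le> \<nu> (X - Y) + \<nu> (Y - Z)"
proof -
  have "X - Z = (X - Y) + (Y - Z)" using assms by (intro eq_matI) auto
  then show ?thesis using norm_triangle[of "X - Y" "Y - Z"] assms by (simp add: minus_carrier_mat)
qed

text \<open>Adding one column at a time adds a rank-one matrix, whose norm is
  \<open>norm_const\<close> times the length of that column. Hence entrywise convergence implies
  convergence in the norm.\<close>

lemma norm_le_sum_entries:
  assumes E: "E \<in> carrier_mat n n"
  shows "\<nu> E \<le> c\<^sub>\<nu> * (\<Sum>j<n. \<Sum>i<n. cmod (E $$ (i, j)))"
proof -
  have "\<nu> (mat n n (\<lambda>(i, j). if j < k then E $$ (i, j) else 0)) \<le> c\<^sub>\<nu> * (\<Sum>j<k. \<Sum>i<n. cmod (E $$ (i, j)))"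
    if "k \<le> n" for k
    using that
  proof (induction k)
    case 0
    have "mat n n (\<lambda>(i, j). if j < 0 then E $$ (i, j) else 0) = 0\<^sub>m n n" by (rule eq_matI) auto
    then show ?case using norm_0_iff[of "0\<^sub>m n n"] by (simp only:) simp
  next
    case (Suc k)
    let ?M = "\<lambda>k. mat n n (\<lambda>(i, j). if j < k then E $$ (i, j) else 0)"
    let ?x = "\<lambda>i. E $$ (i, k)" and ?e = "\<lambda>j. of_bool (j = k) :: complex"
    have "?M (Suc k) = ?M k + outer n ?x ?e" by (rule eq_matI) (auto simp: outer_def less_Suc_eq)
    then have "\<nu> (?M (Suc k)) \<le> \<nu> (?M k) + \<nu> (outer n ?x ?e)"
      using norm_triangle[of "?M k" "outer n ?x ?e"] by simp
    also have "\<nu> (outer n ?x ?e) = c\<^sub>\<nu> * l2 n ?x" using Suc.prems by (simp add: norm_outer l2_of_bool)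
    also have "l2 n ?x \<le> (\<Sum>i<n. cmod (?x i))"
    proof -
      have "(l2 n ?x)\<^sup>2 \<le> (\<Sum>i<n. cmod (?x i))\<^sup>2"
        \<comment> \<open>Expanding the square on the right only adds nonnegative cross
          terms.\<close>
        unfolding l2_sq by (induction n) (auto simp: power2_sum sum_nonneg intro: order_trans)
      then show ?thesis by (rule power2_le_imp_le) (simp add: sum_nonneg)
    qed
    finally show ?case using Suc norm_const_pos by (simp add: algebra_simps)
  qed
  from this[of n] have "\<nu> (mat n n (\<lambda>(i, j). if j < n then E $$ (i, j) else 0)) \<le> c\<^sub>\<nu> * (\<Sum>j<n. \<Sum>i<n. cmod (E $$ (i, j)))"
    by simp
  also have "mat n n (\<lambda>(i, j). if j < n then E $$ (i, j) else 0) = E" using E by (intro eq_matI) auto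
  finally show ?thesis .
qed

text \<open>Shows that the infimum defining the complex distance is taken over a nonempty
  set.\<close>

lemma zero_stable: "0\<^sub>m n n \<in> stable_mats n"
proof -
  have "Re z \<le> 0" if ev: "eigenvalue (0\<^sub>m n n :: complex mat) z" for z
  proof -
    obtain v where v: "v \<in> carrier_vec n" "v \<noteq> 0\<^sub>v n" "0\<^sub>m n n *\<^sub>v v = z \<cdot>\<^sub>v v"
      using ev unfolding eigenvalue_def eigenvector_def index_zero_mat by blast
    then obtain i where i: "i < n" "v $ i \<noteq> 0" by (metis carrier_vecD eq_vecI index_zero_vec)
    have "(0\<^sub>m n n *\<^sub>v v) $ i = 0" using i v(1) by (simp add: scalar_prod_def)
    with v i have "z = 0" by auto
    then show ?thesis by simp
  qed
  then show ?thesis by (simp add: stable_mats_def)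
qed

lemma dist_complex_le:
  assumes "A \<in> carrier_mat n n" "X \<in> stable_mats n"
  shows "dist_complex n \<nu> A \<le> \<nu> (map_mat complex_of_real A - X)"
  unfolding dist_complex_def
proof (rule cINF_lower)
  show "bdd_below ((\<lambda>X. \<nu> (map_mat complex_of_real A - X)) ` stable_mats n)"
    using assms by (intro bdd_belowI[of _ 0]) (auto simp: stable_mats_def intro!: norm_nonneg)
qed fact

text \<open>The direct method: a minimizing sequence has bounded entries, a subsequence converges
  entrywise, its limit is stable by closedness, and the norm of the difference passes to the
  limit.\<close>

lemma nearest_complex_stable_exists:
  assumes A: "A \<in> carrier_mat n n"
  shows "\<exists>X. nearest_complex_stable n \<nu> A X"
proof -
  let ?A = "map_mat complex_of_real A" and ?d = "dist_complex n \<nu> A"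
  have Ac: "?A \<in> carrier_mat n n" using A by simp
  have "\<exists>X\<in>stable_mats n. \<nu> (?A - X) < ?d + inverse (of_nat (Suc k))" for k
  proof (rule ccontr)
    assume "\<not> ?thesis"
    then have "?d + inverse (of_nat (Suc k)) \<le> ?d"
      unfolding dist_complex_def[of n \<nu> A]
      using zero_stable by (intro cINF_greatest) (auto simp: not_less dist_complex_def)
    then show False by (simp add: not_le)
  qed
  then obtain X where X: "\<And>k. X k \<in> stable_mats n" "\<And>k. \<nu> (?A - X k) < ?d + inverse (of_nat (Suc k))"
    by metis
  have Xc: "X k \<in> carrier_mat n n" for k using X(1)[of k] by (simp add: stable_mats_def)
  have "\<exists>r. strict_mono r \<and> (\<forall>ij\<in>{..<n} \<times> {..<n}. convergent ((\<lambda>k. X k $$ ij) \<circ> r))"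
  proof (rule finite_family_convergent_subseq)
    fix ij assume "ij \<in> {..<n} \<times> {..<n}"
    then obtain i j where ij: "ij = (i, j)" "i < n" "j < n" by auto
    show "Bseq (\<lambda>k. X k $$ ij)"
    proof (rule BseqI')
      fix k
      have "c\<^sub>\<nu> * cmod ((?A - X k) $$ (i, j)) \<le> ?d + 1"
      proof -
        have "inverse (real (Suc k)) \<le> 1" by (simp add: inverse_le_1_iff)
        then show ?thesis
          using norm_ge_entry[of "?A - X k" i j] X(2)[of k] Xc[of k] ij by (simp add: minus_carrier_mat)
      qed
      then have "cmod ((?A - X k) $$ (i, j)) \<le> (?d + 1) / c\<^sub>\<nu>"
        using norm_const_pos by (simp add: field_simps)
      moreover have "X k $$ (i, j) = ?A $$ (i, j) - (?A - X k) $$ (i, j)"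
        using ij A carrier_matD[OF Xc[of k]] by simp
      ultimately show "norm (X k $$ ij) \<le> cmod (?A $$ (i, j)) + (?d + 1) / c\<^sub>\<nu>"
        using norm_triangle_ineq4[of "?A $$ (i, j)" "(?A - X k) $$ (i, j)"] ij(1) by simp
    qed
  qed auto
  then obtain r where r: "strict_mono r" "\<And>i j. i < n \<Longrightarrow> j < n \<Longrightarrow> convergent (\<lambda>k. X (r k) $$ (i, j))"
    by (auto simp: o_def)
  define L where "L = mat n n (\<lambda>(i, j). lim (\<lambda>k. X (r k) $$ (i, j)))"
  have Lc: "L \<in> carrier_mat n n" by (simp add: L_def)
  have lim: "(\<lambda>k. X (r k) $$ (i, j)) \<longlonglongrightarrow> L $$ (i, j)" if "i < n" "j < n" for i j
    using r(2)[OF that] that by (simp add: L_def convergent_LIMSEQ_iff)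
  have L: "L \<in> stable_mats n" by (rule stable_mats_limit[OF X(1) Lc lim])
  have "\<nu> (?A - L) \<le> ?d"
  \<comment> \<open>The triangle inequality through \<open>X (r k)\<close> bounds the constant left
    side by a sequence with limit \<open>?d\<close>: the excess of the minimizing sequence and the
    entrywise error both tend to 0.\<close>
  proof (rule LIMSEQ_le_const)
    have "(\<lambda>k. c\<^sub>\<nu> * (\<Sum>j<n. \<Sum>i<n. cmod ((X (r k) - L) $$ (i, j)))) \<longlonglongrightarrow> c\<^sub>\<nu> * (\<Sum>j<n. \<Sum>i<n. cmod 0)"
    proof (intro tendsto_intros)
      fix i j assume "j \<in> {..<n}" "i \<in> {..<n}"
      then have ij: "i < n" "j < n" by auto
      have "(\<lambda>k. X (r k) $$ (i, j) - L $$ (i, j)) \<longlonglongrightarrow> L $$ (i, j) - L $$ (i, j)"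
        by (intro tendsto_intros lim ij)
      then show "(\<lambda>k. (X (r k) - L) $$ (i, j)) \<longlonglongrightarrow> 0"
        using ij carrier_matD[OF Lc] carrier_matD[OF Xc] by simp
    qed
    moreover have "(\<lambda>k. inverse (real (Suc (r k)))) \<longlonglongrightarrow> 0"
      using LIMSEQ_subseq_LIMSEQ[OF LIMSEQ_inverse_real_of_nat r(1)] by (simp add: o_def)
    ultimately show "(\<lambda>k. ?d + inverse (real (Suc (r k))) + c\<^sub>\<nu> * (\<Sum>j<n. \<Sum>i<n. cmod ((X (r k) - L) $$ (i, j)))) \<longlonglongrightarrow> ?d"
      using tendsto_add[OF tendsto_add[OF tendsto_const]] by fastforce
    have "\<nu> (?A - L) \<le> ?d + inverse (real (Suc (r k))) + c\<^sub>\<nu> * (\<Sum>j<n. \<Sum>i<n. cmod ((X (r k) - L) $$ (i, j)))" for k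
      using norm_triangle_minus[OF Ac Xc[of "r k"] Lc] X(2)[of "r k"]
        norm_le_sum_entries[of "X (r k) - L"] Xc[of "r k"] Lc by (simp add: minus_carrier_mat)
    then show "\<exists>N. \<forall>k\<ge>N. \<nu> (?A - L) \<le> ?d + inverse (real (Suc (r k))) + c\<^sub>\<nu> * (\<Sum>j<n. \<Sum>i<n. cmod ((X (r k) - L) $$ (i, j)))"
      by blast
  qed
  then show ?thesis
    using dist_complex_le[OF A L] L by (auto simp: nearest_complex_stable_def)
qed

end

section \<open>The matrix family, its characteristic polynomial and a stability criterion\<close>

text \<open>The matrix \<open>A\<close> and the two stable matrices compared with it differ only in the entries
  \<open>a\<close>, \<open>b\<close>, \<open>e\<close>.\<close>

definition B_mat :: "nat \<Rightarrow> 'a :: field \<Rightarrow> 'a \<Rightarrow> 'a \<Rightarrow> 'a \<Rightarrow> 'a mat" where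
  "B_mat n m a b e = mat n n (\<lambda>(i, j).
     if i = 0 then (if j = 0 then - (m ^ 4) else if j = 1 then m ^ 2 else if j = 2 then a else 0)
     else if i = 1 then (if j = 2 then b else 0)
     else if i = 2 then (if j = 0 then m ^ 6 else if j = 1 then e else 0)
     else if i = j then - (m ^ 2) else 0)"

lemma B_mat_carrier [simp]: "B_mat n m a b e \<in> carrier_mat n n"
  by (simp add: B_mat_def)

lemma A3_carrier: "A3 m \<in> carrier_mat 3 3"
  by (rule carrier_matI) (simp_all add: A3_def mat_of_rows_list_def)

lemma A_mat_four_block:
  "A_mat m n = four_block_mat (A3 m) (0\<^sub>m 3 (n - 3)) (0\<^sub>m (n - 3) 3) (- (m ^ 2) \<cdot>\<^sub>m 1\<^sub>m (n - 3))"
  unfolding A_mat_def diag_block_mat.simps(2)[of "A3 m"] diag_block_mat_singleton Let_def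
  by (simp add: carrier_matD[OF A3_carrier])

lemma A_mat_eq_B_mat: "3 \<le> n \<Longrightarrow> A_mat m n = B_mat n m 0 (m ^ 2) 1"
proof (rule eq_matI)
  fix i j assume "3 \<le> n" "i < dim_row (B_mat n m 0 (m ^ 2) 1)" "j < dim_col (B_mat n m 0 (m ^ 2) 1)"
  then have ij: "3 \<le> n" "i < n" "j < n" by (simp_all add: B_mat_def)
  have "i = 0 \<or> i = 1 \<or> i = 2 \<or> 3 \<le> i" "j = 0 \<or> j = 1 \<or> j = 2 \<or> 3 \<le> j" by linarith+
  then show "A_mat m n $$ (i, j) = B_mat n m 0 (m ^ 2) 1 $$ (i, j)"
    using ij carrier_matD[OF A3_carrier, of m]
    by (elim disjE) (auto simp: A_mat_four_block B_mat_def A3_def mat_of_rows_list_def)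
qed (auto simp: A_mat_four_block B_mat_def carrier_matD[OF A3_carrier])

lemma map_mat_B_mat:
  "map_mat complex_of_real (B_mat n m a b e)
    = B_mat n (of_real m) (of_real a) (of_real b) (of_real e)"
  by (rule eq_matI) (auto simp: B_mat_def)

lemma sum_lessThan_split3:
  fixes f :: "nat \<Rightarrow> 'a :: comm_monoid_add"
  assumes "3 \<le> n"
  shows "(\<Sum>j<n. f j) = f 0 + f 1 + f 2 + (\<Sum>j=3..<n. f j)"
proof -
  have "{..<n} = {0, 1, 2} \<union> {3..<n}" using assms by auto
  then show ?thesis by (simp add: sum.union_disjoint ac_simps)
qed

lemma B_mat_mult_vec:
  assumes "3 \<le> n" and v: "v \<in> carrier_vec n"
  shows "(B_mat n m a b e *\<^sub>v v) $ 0 = - (m ^ 4) * v $ 0 + m ^ 2 * v $ 1 + a * v $ 2"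
    and "(B_mat n m a b e *\<^sub>v v) $ 1 = b * v $ 2"
    and "(B_mat n m a b e *\<^sub>v v) $ 2 = m ^ 6 * v $ 0 + e * v $ 1"
    and "\<And>i. 3 \<le> i \<Longrightarrow> i < n \<Longrightarrow> (B_mat n m a b e *\<^sub>v v) $ i = - (m ^ 2) * v $ i"
proof -
  have row: "(B_mat n m a b e *\<^sub>v v) $ i = (\<Sum>j<n. B_mat n m a b e $$ (i, j) * v $ j)" if "i < n" for i
    using that v by (simp add: scalar_prod_def atLeast0LessThan B_mat_def)
  show "(B_mat n m a b e *\<^sub>v v) $ 0 = - (m ^ 4) * v $ 0 + m ^ 2 * v $ 1 + a * v $ 2"
    "(B_mat n m a b e *\<^sub>v v) $ 1 = b * v $ 2"
    "(B_mat n m a b e *\<^sub>v v) $ 2 = m ^ 6 * v $ 0 + e * v $ 1"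
    using row[of 0] row[of 1] row[of 2] assms(1) by (simp_all add: sum_lessThan_split3 B_mat_def del: index_mult_mat_vec)
  fix i assume i: "3 \<le> i" "i < n"
  then have "(B_mat n m a b e *\<^sub>v v) $ i = (\<Sum>j<n. if i = j then - (m ^ 2) * v $ j else 0)"
    unfolding row[OF i(2)] by (intro sum.cong) (auto simp: B_mat_def)
  then show "(B_mat n m a b e *\<^sub>v v) $ i = - (m ^ 2) * v $ i" using i by simp
qed

text \<open>The expression in \<open>roots\<close> is the characteristic polynomial of the leading
  block of size 3; the rest of the matrix only contributes the eigenvalue
  \<open>- (m ^ 2)\<close>.\<close>

lemma B_mat_stable:
  assumes n: "3 \<le> n" and m: "m \<noteq> 0"
    and roots: "\<And>z. 0 < Re z \<Longrightarrow>
      (z + of_real m ^ 4) * (z\<^sup>2 - e * b) - of_real m ^ 8 * b - of_real m ^ 6 * a * z \<noteq> 0"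
  shows "B_mat n (of_real m) a b e \<in> stable_mats n"
proof -
  let ?M = "complex_of_real m"
  have "\<not> 0 < Re z" if ev: "eigenvalue (B_mat n ?M a b e) z" for z
  proof
    assume z: "0 < Re z"
    obtain v where v: "v \<in> carrier_vec n" "v \<noteq> 0\<^sub>v n" "B_mat n ?M a b e *\<^sub>v v = z \<cdot>\<^sub>v v"
      using ev by (auto simp: eigenvalue_def eigenvector_def B_mat_def)
    have i: "(B_mat n ?M a b e *\<^sub>v v) $ i = z * v $ i" if "i < n" for i
      using v that by simp
    note r = B_mat_mult_vec[OF n v(1)]
    have e0: "- (?M ^ 4) * v $ 0 + ?M ^ 2 * v $ 1 + a * v $ 2 = z * v $ 0"
      and e1: "b * v $ 2 = z * v $ 1" and e2: "?M ^ 6 * v $ 0 + e * v $ 1 = z * v $ 2"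
      using r(1-3) i[of 0] i[of 1] i[of 2] n by simp_all
    have z0: "z \<noteq> 0" using z by auto
    let ?p = "(z + ?M ^ 4) * (z\<^sup>2 - e * b) - ?M ^ 8 * b - ?M ^ 6 * a * z"
    \<comment> \<open>The multipliers of the three eigenvector equations are the last row of the
      adjugate of \<open>z\<close> times the identity minus the leading block, which eliminates
      \<open>v $ 0\<close> and \<open>v $ 1\<close>.\<close>
    have "?p * v $ 2 = (z + ?M ^ 4) * z * (z * v $ 2 - ?M ^ 6 * v $ 0 - e * v $ 1)
        + z * ?M ^ 6 * (z * v $ 0 - (- (?M ^ 4) * v $ 0 + ?M ^ 2 * v $ 1 + a * v $ 2))
        + (?M ^ 8 + (z + ?M ^ 4) * e) * (z * v $ 1 - b * v $ 2)"
      by (simp add: algebra_simps eval_nat_numeral)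
    then have "?p * v $ 2 = 0" by (simp only: e0 e1 e2[symmetric]) simp
    then have v2: "v $ 2 = 0" using roots[OF z] by simp
    then have v1: "v $ 1 = 0" using e1 z0 by simp
    then have v0: "v $ 0 = 0" using e2 v2 m by simp
    have "v $ i = 0" if "3 \<le> i" "i < n" for i
    proof -
      have "(z + ?M ^ 2) * v $ i = 0" using r(4)[OF that, of ?M a b e] i[OF that(2)] by (simp add: algebra_simps)
      moreover have "0 < Re (z + ?M ^ 2)" using z by (simp add: add_pos_nonneg flip: of_real_power)
      then have "z + ?M ^ 2 \<noteq> 0" by (metis zero_complex.sel(1) less_irrefl)
      ultimately show ?thesis by simp
    qed
    with v0 v1 v2 have "v $ i = 0" if "i < n" for i
      using that by (cases "3 \<le> i") (auto simp: not_le numeral_3_eq_3 less_Suc_eq numeral_2_eq_2)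
    then have "v = 0\<^sub>v n" using v(1) by (intro eq_vecI) auto
    with v(2) show False by simp
  qed
  then show ?thesis by (auto simp: stable_mats_def not_less)
qed

section \<open>Signs of determinants and the exact real distance\<close>

lemma det_2x2:
  assumes A: "(A :: 'a :: comm_ring_1 mat) \<in> carrier_mat 2 2"
  shows "det A = A $$ (0, 0) * A $$ (1, 1) - A $$ (0, 1) * A $$ (1, 0)"
proof -
  have 1: "det M = M $$ (0, 0)" if "M \<in> carrier_mat 1 1" for M :: "'a mat"
    using that by (rule det_single)
  have "mat_delete A i 0 \<in> carrier_mat 1 1" for i
    using mat_delete_carrier[OF A] by simp
  then show ?thesis
    unfolding laplace_expansion_column[OF A, of 0, simplified]
    using A by (simp add: cofactor_def 1 numeral_2_eq_2 mat_delete_def)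
qed

lemma det_A3: "det (A3 m) = m ^ 10 + m ^ 6"
proof -
  have del: "mat_delete (A3 m) i 0 \<in> carrier_mat 2 2" for i
    using mat_delete_carrier[OF A3_carrier] by simp
  show ?thesis
    unfolding laplace_expansion_column[OF A3_carrier, of 0, simplified]
    by (simp add: cofactor_def det_2x2[OF del] numeral_3_eq_3)
      (simp add: mat_delete_def A3_def mat_of_rows_list_def algebra_simps flip: power_add)
qed

lemma det_uminus: "(A :: 'a :: comm_ring_1 mat) \<in> carrier_mat n n \<Longrightarrow> det (- A) = (-1) ^ n * det A"
proof -
  assume A: "A \<in> carrier_mat n n"
  then have "- A = (-1) \<cdot>\<^sub>m A" by (intro eq_matI) auto
  then show ?thesis using A by simp
qed

lemma det_uminus_A_mat_neg:
  assumes "3 \<le> n" "0 < m"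
  shows "det (- A_mat m n) < 0"
proof -
  have c: "A_mat m n \<in> carrier_mat n n" using assms(1) by (simp add: A_mat_eq_B_mat)
  have "det (A_mat m n) = (m ^ 10 + m ^ 6) * (- (m ^ 2)) ^ (n - 3)"
    unfolding A_mat_four_block
    by (subst det_four_block_mat_lower_left_zero[of _ 3 _ "n - 3"]) (simp_all add: A3_carrier det_A3)
  also have "(- (m ^ 2)) ^ (n - 3) = (-1) ^ (n - 3) * (m ^ 2) ^ (n - 3)"
    by (rule power_minus)
  finally have "det (- A_mat m n) = ((-1) ^ n * (-1) ^ (n - 3)) * ((m ^ 10 + m ^ 6) * (m ^ 2) ^ (n - 3))"
    by (simp add: det_uminus[OF c])
  \<comment> \<open>The total exponent \<open>2 * n - 3\<close> is odd, so the sign does not depend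
    on \<open>n\<close>.\<close>
  also have "(-1 :: real) ^ n * (-1) ^ (n - 3) = -1"
    using assms(1) by (simp flip: power_add)
  finally show ?thesis using assms(2) by (simp add: add_pos_pos)
qed

text \<open>For a monic real polynomial without positive roots the value at 0 is nonnegative.\<close>

lemma det_uminus_stable_nonneg:
  assumes Y: "Y \<in> carrier_mat n n" and st: "map_mat complex_of_real Y \<in> stable_mats n"
  shows "0 \<le> det (- Y)"
proof (rule ccontr)
  assume "\<not> ?thesis"
  \<comment> \<open>This identifies \<open>det (- Y)\<close> with the characteristic polynomial at
    0.\<close>
  moreover have "- Y = - char_matrix Y 0" using Y by (intro eq_matI) (auto simp: char_matrix_def)
  ultimately have neg: "poly (char_poly Y) 0 < 0" using char_poly_matrix[OF Y, of 0] by simp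
  have lc: "lead_coeff (char_poly Y) = 1" using degree_monic_char_poly[OF Y] by simp
  obtain x where "\<And>y. x \<le> y \<Longrightarrow> 1 \<le> poly (char_poly Y) y"
    using poly_pinfty_gt_lc[of "char_poly Y"] lc by auto
  \<comment> \<open>The maximum with 1 puts the point of positive value to the right of 0, so that
    the intermediate root is positive.\<close>
  from this[of "max x 1"] have "0 < poly (char_poly Y) (max x 1)" by simp
  moreover have "0 < max x 1" by (simp add: less_max_iff_disj)
  ultimately obtain y where y: "0 < y" "poly (char_poly Y) y = 0"
    using poly_IVT_pos[OF _ neg] by blast
  have "poly (char_poly (map_mat complex_of_real Y)) (of_real y) = 0"
    unfolding of_real_hom.char_poly_hom[OF Y] using y(2) by simp
  then have "eigenvalue (map_mat complex_of_real Y) (of_real y)"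
    using eigenvalue_root_char_poly[of "map_mat complex_of_real Y" n] Y by simp
  with st y(1) show False by (auto simp: stable_mats_def)
qed

text \<open>Orthogonality of the columns cancels the cross terms and leaves a weighted sum of
  squares with weights \<open>m ^ 8 + m ^ 12\<close>, \<open>m ^ 4 + 1\<close> and otherwise
  \<open>m ^ 4\<close>; the last is the least since \<open>1 \<le> m\<close>.\<close>

lemma A_mat_expands:
  assumes n: "3 \<le> n" and m: "1 \<le> m" and v: "v \<in> carrier_vec n"
  shows "m ^ 4 * (\<Sum>i<n. (v $ i)\<^sup>2) \<le> (\<Sum>i<n. ((A_mat m n *\<^sub>v v) $ i)\<^sup>2)"
proof -
  note r = B_mat_mult_vec[OF n v]
  have "(\<Sum>i<n. ((A_mat m n *\<^sub>v v) $ i)\<^sup>2)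
      = (- (m ^ 4) * v $ 0 + m ^ 2 * v $ 1)\<^sup>2 + (m ^ 2 * v $ 2)\<^sup>2 + (m ^ 6 * v $ 0 + v $ 1)\<^sup>2
        + (\<Sum>i=3..<n. m ^ 4 * (v $ i)\<^sup>2)"
    unfolding A_mat_eq_B_mat[OF n] sum_lessThan_split3[OF n] r(1-3)
    by (intro arg_cong2[of _ _ _ _ "(+)"] sum.cong)
      (simp_all add: r(4) power_mult_distrib flip: power_mult)
  also have "\<dots> = m ^ 4 * (\<Sum>i<n. (v $ i)\<^sup>2) + (m ^ 8 + m ^ 12 - m ^ 4) * (v $ 0)\<^sup>2 + (v $ 1)\<^sup>2"
    unfolding sum_lessThan_split3[OF n] sum_distrib_left[symmetric]
    by (simp add: algebra_simps eval_nat_numeral)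
  also have "\<dots> \<ge> m ^ 4 * (\<Sum>i<n. (v $ i)\<^sup>2)"
  proof -
    have "m ^ 4 \<le> m ^ 8" "0 \<le> m ^ 12" using m by (simp_all add: power_increasing)
    then have "0 \<le> m ^ 8 + m ^ 12 - m ^ 4" by linarith
    then show ?thesis by simp
  qed
  finally show ?thesis .
qed

context unitarily_invariant
begin

lemma real_stable_lower_bound:
  assumes n: "3 \<le> n" and m: "1 \<le> m" and X: "X \<in> stable_mats n \<inter> real_mats n"
  shows "c\<^sub>\<nu> * m ^ 2 \<le> \<nu> (map_mat complex_of_real (A_mat m n) - X)"
proof -
  let ?A = "A_mat m n"
  have A: "?A \<in> carrier_mat n n" using n by (simp add: A_mat_eq_B_mat)
  obtain Y where Y: "Y \<in> carrier_mat n n" "X = map_mat complex_of_real Y"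
    using X by (auto simp: real_mats_def)
  \<comment> \<open>Minus the point at parameter \<open>t\<close> of the segment from
    \<open>?A\<close> to \<open>Y\<close>.\<close>
  define P where "P t = - (?A + t \<cdot>\<^sub>m (Y - ?A))" for t
  have P: "P t \<in> carrier_mat n n" for t using A Y by (simp add: P_def minus_carrier_mat)
  have "P 0 = - ?A" "P 1 = - Y" unfolding P_def using A Y by (auto intro!: eq_matI)
  then have "det (P 0) < 0" "0 \<le> det (P 1)"
    using det_uminus_A_mat_neg[OF n, of m] det_uminus_stable_nonneg[OF Y(1)] X Y(2) m by auto
  moreover have "continuous_on {0..1} (\<lambda>t. det (P t))"
    unfolding continuous_on_def
  proof (intro ballI tendsto_det P)
    fix t and i j assume ij: "i < n" "j < n"
    have P_ij: "P s $$ (i, j) = - (?A $$ (i, j) + s * (Y $$ (i, j) - ?A $$ (i, j)))" for s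
      using ij carrier_matD[OF A] carrier_matD[OF Y(1)] by (simp add: P_def)
    show "((\<lambda>s. P s $$ (i, j)) \<longlongrightarrow> P t $$ (i, j)) (at t within {0..1})"
      unfolding P_ij by (intro tendsto_intros)
  qed (simp_all add: P)
  ultimately obtain t where t: "0 \<le> t" "t \<le> 1" "det (P t) = 0"
    using IVT'[of "\<lambda>t. det (P t)" 0 0 1] by auto
  obtain v where v: "v \<in> carrier_vec n" "v \<noteq> 0\<^sub>v n" "P t *\<^sub>v v = 0\<^sub>v n"
    using det_0_iff_vec_prod_zero[OF P] t(3) by blast
  let ?x = "\<lambda>i. complex_of_real (v $ i)"
  let ?E = "map_mat complex_of_real ?A - X"
  have E: "?E \<in> carrier_mat n n" using Y by (simp add: minus_carrier_mat)
  have Av: "(?A *\<^sub>v v) $ i = (\<Sum>j<n. ?A $$ (i, j) * v $ j)" if "i < n" for i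
    using that A v(1) by (simp add: scalar_prod_def atLeast0LessThan)
  \<comment> \<open>The kernel equation \<open>P t *\<^sub>v v = 0\<^sub>v n\<close> rewritten as
    \<open>A v = t E v\<close>, moved to complex scalars because the norm acts on complex
    matrices.\<close>
  have Av_app: "complex_of_real ((?A *\<^sub>v v) $ i) = of_real t * app n ?E ?x i" if i: "i < n" for i
  proof -
    have "0 = (\<Sum>j<n. P t $$ (i, j) * v $ j)"
      using arg_cong[OF v(3), of "\<lambda>u. u $ i"] i P[of t] v(1)
      by (simp add: scalar_prod_def atLeast0LessThan)
    also have "\<dots> = (\<Sum>j<n. t * ((?A $$ (i, j) - Y $$ (i, j)) * v $ j) - ?A $$ (i, j) * v $ j)"
      using i A Y by (intro sum.cong) (auto simp: P_def algebra_simps)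
    also have "\<dots> = t * (\<Sum>j<n. (?A $$ (i, j) - Y $$ (i, j)) * v $ j) - (?A *\<^sub>v v) $ i"
      unfolding sum_subtractf sum_distrib_left Av[OF i] ..
    finally have "complex_of_real ((?A *\<^sub>v v) $ i) = of_real (t * (\<Sum>j<n. (?A $$ (i, j) - Y $$ (i, j)) * v $ j))"
      by simp
    also have "\<dots> = of_real t * app n ?E ?x i"
      unfolding app_def of_real_mult of_real_sum using i A Y
      by (intro arg_cong2[of _ _ _ _ "(*)"] sum.cong) auto
    finally show ?thesis .
  qed
  have l2x: "(l2 n ?x)\<^sup>2 = (\<Sum>i<n. (v $ i)\<^sup>2)" by (simp add: l2_sq)
  have "(m ^ 2 * l2 n ?x)\<^sup>2 = m ^ 4 * (\<Sum>i<n. (v $ i)\<^sup>2)"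
    by (simp add: power_mult_distrib l2x flip: power_mult)
  also have "\<dots> \<le> (\<Sum>i<n. ((?A *\<^sub>v v) $ i)\<^sup>2)" by (rule A_mat_expands[OF n m v(1)])
  also have "\<dots> = (\<Sum>i<n. (t * cmod (app n ?E ?x i))\<^sup>2)"
  proof (rule sum.cong)
    fix i assume "i \<in> {..<n}"
    then have "\<bar>(?A *\<^sub>v v) $ i\<bar> = t * cmod (app n ?E ?x i)"
      using arg_cong[OF Av_app[of i], of cmod] t(1) by (simp add: norm_mult del: index_mult_mat_vec)
    then show "((?A *\<^sub>v v) $ i)\<^sup>2 = (t * cmod (app n ?E ?x i))\<^sup>2"
      by (metis power2_abs)
  qed simp
  also have "\<dots> = (t * l2 n (app n ?E ?x))\<^sup>2"
    by (simp add: power_mult_distrib l2_sq sum_distrib_left)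
  finally have "m ^ 2 * l2 n ?x \<le> t * l2 n (app n ?E ?x)"
    by (rule power2_le_imp_le) (simp add: t(1))
  also have "\<dots> \<le> 1 * l2 n (app n ?E ?x)" using t(2) by (intro mult_right_mono) auto
  finally have "c\<^sub>\<nu> * m ^ 2 * l2 n ?x \<le> c\<^sub>\<nu> * l2 n (app n ?E ?x)"
    using norm_const_pos by (simp add: mult.assoc)
  also have "\<dots> \<le> \<nu> ?E * l2 n ?x" by (rule norm_ge_app[OF E])
  finally have le: "c\<^sub>\<nu> * m ^ 2 * l2 n ?x \<le> \<nu> ?E * l2 n ?x" .
  have "l2 n ?x \<noteq> 0"
  proof
    assume "l2 n ?x = 0"
    then have "v = 0\<^sub>v n" using v(1) by (intro eq_vecI) (auto simp: l2_eq_0_iff)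
    with v(2) show False ..
  qed
  then have "0 < l2 n ?x" using l2_nonneg[of n ?x] by linarith
  with le show ?thesis by (simp add: mult_le_cancel_right_pos)
qed

text \<open>Deleting the entry \<open>m ^ 2\<close> in position \<open>(1, 2)\<close> leaves the
  characteristic polynomial \<open>(z + m^4) z^2\<close> for the leading block. This is a rank-one
  change of norm \<open>norm_const\<close> times \<open>m ^ 2\<close>, which meets the lower
  bound.\<close>

lemma nearest_real_stable_A_mat:
  assumes n: "3 \<le> n" and m: "1 \<le> m"
  shows "nearest_real_stable n \<nu> (A_mat m n) (B_mat n (of_real m) 0 0 1)"
    and "dist_real n \<nu> (A_mat m n) = c\<^sub>\<nu> * m ^ 2"
proof -
  let ?A = "map_mat complex_of_real (A_mat m n)" and ?X = "B_mat n (complex_of_real m) 0 0 1"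
  have "?X \<in> stable_mats n"
  proof (rule B_mat_stable[OF n])
    fix z :: complex assume z: "0 < Re z"
    then have "0 < Re (z + of_real m ^ 4)" by (simp add: add_pos_nonneg flip: of_real_power)
    then have "z + of_real m ^ 4 \<noteq> 0" by (metis zero_complex.sel(1) less_irrefl)
    moreover have "z \<noteq> 0" using z by auto
    ultimately show "(z + of_real m ^ 4) * (z\<^sup>2 - 1 * 0) - of_real m ^ 8 * 0 - of_real m ^ 6 * 0 * z \<noteq> 0"
      by simp
  qed (use m in simp)
  moreover have "?X \<in> real_mats n"
    unfolding real_mats_def using map_mat_B_mat[of n m 0 0 1]
    by (intro image_eqI[of _ _ "B_mat n m 0 0 1"]) simp_all
  ultimately have X: "?X \<in> stable_mats n \<inter> real_mats n" by simp
  have "?A - ?X = outer n (\<lambda>i. of_real (m ^ 2) * of_bool (i = 1)) (\<lambda>j. of_bool (j = 2))"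
    unfolding A_mat_eq_B_mat[OF n] by (rule eq_matI) (auto simp: outer_def B_mat_def)
  moreover have "l2 n (\<lambda>i. of_real (m ^ 2) * of_bool (i = 1)) = sqrt ((m ^ 2)\<^sup>2)"
    using n by (simp add: l2_def sum_lessThan_split3 norm_mult norm_power)
  then have "l2 n (\<lambda>i. of_real (m ^ 2) * of_bool (i = 1)) = m ^ 2"
    by (simp only: real_sqrt_abs abs_power2)
  ultimately have \<nu>: "\<nu> (?A - ?X) = c\<^sub>\<nu> * m ^ 2"
    using n by (simp add: norm_outer l2_of_bool)
  have "dist_real n \<nu> (A_mat m n) = \<nu> (?A - ?X)"
    unfolding dist_real_def
  proof (rule cInf_eq_minimum)
    show "\<nu> (?A - ?X) \<in> (\<lambda>X. \<nu> (?A - X)) ` (stable_mats n \<inter> real_mats n)" using X by blast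
  qed (use real_stable_lower_bound[OF n m] in \<open>auto simp: \<nu>\<close>)
  with X \<nu> show "nearest_real_stable n \<nu> (A_mat m n) ?X" "dist_real n \<nu> (A_mat m n) = c\<^sub>\<nu> * m ^ 2"
    by (simp_all add: nearest_real_stable_def)
qed

section \<open>Upper bound for the complex distance\<close>

text \<open>The entries are chosen so that the characteristic polynomial of the leading block is
  \<open>(z - i m\<^sup>3)\<^sup>2 (z + m\<^sup>4 + 2 i m\<^sup>3)\<close>.\<close>

lemma complex_stable_near_A_mat:
  assumes n: "3 \<le> n" and m: "0 < m"
  defines "X \<equiv> B_mat n (complex_of_real m) (Complex (-3) (2 * m)) (Complex (m ^ 2) (2 * m)) 0"
  shows "X \<in> stable_mats n"
    and "\<nu> (map_mat complex_of_real (A_mat m n) - X) \<le> c\<^sub>\<nu> * (1 + sqrt (8 * m ^ 2 + 9))"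
proof -
  let ?A = "map_mat complex_of_real (A_mat m n)" and ?M = "complex_of_real m"
  have ab: "Complex (-3) (2 * m) = -3 + 2 * \<i> * ?M" "Complex (m ^ 2) (2 * m) = ?M ^ 2 + 2 * \<i> * ?M"
    by (simp_all add: Complex_eq)
  show "X \<in> stable_mats n"
    unfolding X_def
  proof (rule B_mat_stable[OF n])
    fix z :: complex assume z: "0 < Re z"
    have im: "Re (\<i> * ?M ^ 3) = 0" by (simp flip: of_real_power)
    have "0 < Re (z - \<i> * ?M ^ 3)" using z im by simp
    then have "z - \<i> * ?M ^ 3 \<noteq> 0" by (metis zero_complex.sel(1) less_irrefl)
    moreover have "0 < Re (z + ?M ^ 4 + 2 * (\<i> * ?M ^ 3))"
      using z im by (simp add: add_pos_nonneg flip: of_real_power)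
    then have "z + ?M ^ 4 + 2 * (\<i> * ?M ^ 3) \<noteq> 0" by (metis zero_complex.sel(1) less_irrefl)
    ultimately have "(z - \<i> * ?M ^ 3)\<^sup>2 * (z + ?M ^ 4 + 2 * (\<i> * ?M ^ 3)) \<noteq> 0" by simp
    \<comment> \<open>The trace of the block stays \<open>- (m ^ 4)\<close>, which forces the third
      root once \<open>i m^3\<close> is double; comparing the coefficients of \<open>z\<close> and 1
      then determines \<open>a\<close> and \<open>b\<close>.\<close>
    also have "(z - \<i> * ?M ^ 3)\<^sup>2 * (z + ?M ^ 4 + 2 * (\<i> * ?M ^ 3)) =
        (z + ?M ^ 4) * (z\<^sup>2 - 0 * (?M ^ 2 + 2 * \<i> * ?M)) - ?M ^ 8 * (?M ^ 2 + 2 * \<i> * ?M)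
        - ?M ^ 6 * (-3 + 2 * \<i> * ?M) * z"
      by (simp add: algebra_simps eval_nat_numeral)
    finally show "(z + ?M ^ 4) * (z\<^sup>2 - 0 * Complex (m ^ 2) (2 * m)) - ?M ^ 8 * Complex (m ^ 2) (2 * m)
        - ?M ^ 6 * Complex (-3) (2 * m) * z \<noteq> 0"
      unfolding ab .
  qed (use m in simp)
  let ?e = "\<lambda>k i. of_bool (i = k) :: complex"
  let ?w = "\<lambda>i::nat. if i = 0 then Complex 3 (- 2 * m) else if i = 1 then Complex 0 (- 2 * m) else 0"
  \<comment> \<open>Replacing the entry 1 by 0 costs one rank-one term of norm
    \<open>norm_const\<close>. The changes in \<open>a\<close> and \<open>b\<close> share column 2,
    so they form a single rank-one term with squared length
    \<open>9 + 4 m^2 + 4 m^2\<close>.\<close>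
  have "?A - X = outer n (?e 2) (?e 1) + outer n ?w (?e 2)"
    unfolding A_mat_eq_B_mat[OF n] X_def
    by (rule eq_matI) (auto simp: outer_def B_mat_def complex_eq_iff)
  then have "\<nu> (?A - X) \<le> \<nu> (outer n (?e 2) (?e 1)) + \<nu> (outer n ?w (?e 2))"
    using norm_triangle[of "outer n (?e 2) (?e 1)" "outer n ?w (?e 2)"] by simp
  also have "l2 n ?w = sqrt (8 * m ^ 2 + 9)"
    using n by (simp add: l2_def sum_lessThan_split3 cmod_power2 power_mult_distrib)
  then have "\<nu> (outer n (?e 2) (?e 1)) + \<nu> (outer n ?w (?e 2)) = c\<^sub>\<nu> * (1 + sqrt (8 * m ^ 2 + 9))"
    using n by (simp add: norm_outer l2_of_bool algebra_simps)
  finally show "\<nu> (?A - X) \<le> c\<^sub>\<nu> * (1 + sqrt (8 * m ^ 2 + 9))" .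
qed

end

section \<open>Comparison of the two distances and growth of their ratio\<close>

text \<open>Squaring reduces the claim to \<open>m^4 - 10 m^2 - 8 > 0\<close>, which follows from
  \<open>m^2 \<ge> 16\<close>. It separates the bound for the complex distance strictly from the
  real distance.\<close>

lemma bound_less_square:
  assumes "(4::real) \<le> m"
  shows "1 + sqrt (8 * m ^ 2 + 9) < m ^ 2"
proof -
  have "16 \<le> m\<^sup>2" using power_mono[OF assms, of 2] by simp
  then have "16 * m\<^sup>2 \<le> m\<^sup>2 * m\<^sup>2" by (intro mult_right_mono) auto
  then have "8 * m ^ 2 + 9 < (m ^ 2 - 1)\<^sup>2"
    using \<open>16 \<le> m\<^sup>2\<close> by (simp add: power2_eq_square[of "m\<^sup>2 - 1"] algebra_simps)
  then have "sqrt (8 * m ^ 2 + 9) < m ^ 2 - 1"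
    using \<open>16 \<le> m\<^sup>2\<close> by (intro real_less_lsqrt) auto
  then show ?thesis by simp
qed

text \<open>For \<open>4 \<le> m\<close> the denominator is at most \<open>5 * m\<close>, so the
  ratio dominates \<open>m / 5\<close>.\<close>

lemma ratio_at_top: "filterlim (\<lambda>m::real. m ^ 2 / (1 + sqrt (8 * m ^ 2 + 9))) at_top at_top"
proof (rule filterlim_at_top_mono)
  show "filterlim (\<lambda>m::real. m * (1 / 5)) at_top at_top"
    by (rule filterlim_at_top_mult_tendsto_pos[of _ "1 / 5"]) (auto simp: filterlim_ident mult.commute)
  show "\<forall>\<^sub>F m::real in at_top. m * (1 / 5) \<le> m ^ 2 / (1 + sqrt (8 * m ^ 2 + 9))"
    using eventually_ge_at_top[of 4]
  proof eventually_elim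
    case (elim m)
    have "16 \<le> m\<^sup>2" using power_mono[OF elim, of 2] by simp
    then have "sqrt (8 * m ^ 2 + 9) \<le> 4 * m"
      using elim by (intro real_le_lsqrt) (auto simp: power_mult_distrib)
    then have "m * (1 + sqrt (8 * m ^ 2 + 9)) \<le> m * (5 * m)"
      using elim by (intro mult_left_mono) auto
    then show ?case by (simp add: field_simps power2_eq_square add_pos_nonneg)
  qed
qed

theorem theorem4p1:
  fixes n :: nat and \<nu> :: "complex mat \<Rightarrow> real"
  assumes "n \<ge> 3" and "unitarily_invariant_norm n \<nu>"
  shows "(\<forall>m::real. m \<ge> 4 \<longrightarrow>
            (\<exists>X. nearest_real_stable n \<nu> (A_mat m n) X) \<and>
            (\<exists>X. nearest_complex_stable n \<nu> (A_mat m n) X) \<and>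
            dist_real n \<nu> (A_mat m n) = norm_const n \<nu> * m ^ 2 \<and>
            0 < dist_complex n \<nu> (A_mat m n) \<and>
            dist_complex n \<nu> (A_mat m n) \<le> norm_const n \<nu> * (1 + sqrt (8 * m ^ 2 + 9)) \<and>
            dist_real n \<nu> (A_mat m n) / dist_complex n \<nu> (A_mat m n)
              \<ge> m ^ 2 / (1 + sqrt (8 * m ^ 2 + 9)) \<and>
            (\<forall>X. nearest_complex_stable n \<nu> (A_mat m n) X \<longrightarrow> X \<notin> real_mats n)) \<and>
         filterlim (\<lambda>m::real. m ^ 2 / (1 + sqrt (8 * m ^ 2 + 9))) at_top at_top"
proof (intro conjI[OF _ ratio_at_top] allI impI)
  fix m :: real assume m: "4 \<le> m"
  note n = assms(1)
  interpret unitarily_invariant n \<nu>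
    by unfold_locales (use assms in auto)
  let ?A = "A_mat m n" and ?s = "1 + sqrt (8 * m ^ 2 + 9)"
  have m1: "1 \<le> m" "0 < m" using m by auto
  have A: "?A \<in> carrier_mat n n" using n by (simp add: A_mat_eq_B_mat)
  have s: "0 < ?s" by (simp add: add_pos_nonneg)
  obtain X where X: "nearest_complex_stable n \<nu> ?A X"
    using nearest_complex_stable_exists[OF A] by blast
  have upper: "dist_complex n \<nu> ?A \<le> c\<^sub>\<nu> * ?s"
    using dist_complex_le[OF A complex_stable_near_A_mat(1)[OF n m1(2)]]
      complex_stable_near_A_mat(2)[OF n m1(2)] by (rule order_trans)
  \<comment> \<open>Positivity rests on attainment: distance 0 would make the minimizer
    \<open>X\<close> equal to \<open>?A\<close>, a real stable matrix at distance 0, against the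
    real lower bound.\<close>
  have "0 < dist_complex n \<nu> ?A"
  proof (rule ccontr)
    have Xc: "X \<in> carrier_mat n n" using X by (simp add: nearest_complex_stable_def stable_mats_def)
    assume "\<not> ?thesis"
    then have "\<nu> (map_mat complex_of_real ?A - X) = 0"
      using X norm_nonneg[of "map_mat complex_of_real ?A - X"] Xc
      by (simp add: nearest_complex_stable_def minus_carrier_mat)
    then have zero: "map_mat complex_of_real ?A - X = 0\<^sub>m n n"
      using norm_0_iff Xc by (simp add: minus_carrier_mat)
    have "X = map_mat complex_of_real ?A"
    proof (rule eq_matI)
      fix i j assume ij: "i < dim_row (map_mat complex_of_real ?A)" "j < dim_col (map_mat complex_of_real ?A)"
      then show "X $$ (i, j) = map_mat complex_of_real ?A $$ (i, j)"
        using arg_cong[OF zero, of "\<lambda>M. M $$ (i, j)"] A Xc by simp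
    qed (use A Xc in auto)
    then have "X \<in> stable_mats n \<inter> real_mats n"
      using X A by (auto simp: nearest_complex_stable_def real_mats_def)
    from real_stable_lower_bound[OF n m1(1) this] \<open>\<nu> (map_mat complex_of_real ?A - X) = 0\<close>
    show False using norm_const_pos m1 by (simp add: mult_le_0_iff)
  qed
  moreover have "m ^ 2 / ?s \<le> dist_real n \<nu> ?A / dist_complex n \<nu> ?A"
  proof -
    have "m ^ 2 / ?s = c\<^sub>\<nu> * m ^ 2 / (c\<^sub>\<nu> * ?s)" using norm_const_pos by simp
    also have "\<dots> \<le> c\<^sub>\<nu> * m ^ 2 / dist_complex n \<nu> ?A"
      using upper \<open>0 < dist_complex n \<nu> ?A\<close> norm_const_pos s by (intro divide_left_mono) auto
    finally show ?thesis by (simp add: nearest_real_stable_A_mat(2)[OF n m1(1)])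
  qed
  moreover have "Z \<notin> real_mats n" if Z: "nearest_complex_stable n \<nu> ?A Z" for Z
  proof
    assume "Z \<in> real_mats n"
    \<comment> \<open>A real minimizer is subject to the real lower bound, which exceeds the upper
      bound for the complex distance.\<close>
    then have "c\<^sub>\<nu> * m ^ 2 \<le> dist_complex n \<nu> ?A"
      using real_stable_lower_bound[OF n m1(1), of Z] Z by (auto simp: nearest_complex_stable_def)
    also have "\<dots> \<le> c\<^sub>\<nu> * ?s" by (rule upper)
    also have "\<dots> < c\<^sub>\<nu> * m ^ 2"
      using bound_less_square[OF m] norm_const_pos by (intro mult_strict_left_mono)
    finally show False by simp
  qed
  ultimately show "(\<exists>X. nearest_real_stable n \<nu> ?A X) \<and>
      (\<exists>X. nearest_complex_stable n \<nu> ?A X) \<and>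
      dist_real n \<nu> ?A = c\<^sub>\<nu> * m ^ 2 \<and>
      0 < dist_complex n \<nu> ?A \<and>
      dist_complex n \<nu> ?A \<le> c\<^sub>\<nu> * ?s \<and>
      dist_real n \<nu> ?A / dist_complex n \<nu> ?A \<ge> m ^ 2 / ?s \<and>
      (\<forall>X. nearest_complex_stable n \<nu> ?A X \<longrightarrow> X \<notin> real_mats n)"
    using nearest_real_stable_A_mat[OF n m1(1)] X upper by blast
qed

end
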